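(* Suppose that for each $\delta\in\mathcal K^*\setminus\{0\}$ there exists $x_\delta\in\mathcal S(A,\mathcal K,\mathcal B)$ with $\langle\delta,x_\delta\rangle>0$. Then any generating set of the cone $C_s(A,\mathcal K,\mathcal B)$ of $\mathcal K$-sublinear inequalities is of the form $(G_L,G_s)$ where $G_s\supseteq G_C^+$ for some generating set $(G_L,G_C)$ of $C(A,\mathcal K,\mathcal B)$. Moreover, if $(\mu;\eta_0)\in G_s\setminus G_C^+$, then $(\mu;\eta_0)$ is not $\mathcal K$-minimal.
   Context: Setting: $E$ is a finite-dimensional Euclidean space with inner product $\langle\cdot,\cdot\rangle$; $\mathcal K\subset E$ is a regular cone (closed, convex, pointed, full-dimensional); $\mathcal K^*=\{y\in E:\langle x,y\rangle\ge0\ \forall x\in\mathcal K\}$ is its dual cone; $A:E\to\mathbb R^m$ is linear; $\mathcal B\subseteq\mathbb R^m$ is an arbitrary nonempty set; $\mathcal S(A,\mathcal K,\mathcal B)=\{x\in\mathcal K: Ax\in\mathcal B\}$, assumed to satisfy $\mathcal S(A,\mathcal K,\mathcal B)\neq\emptyset$ and $\mathcal S(A,\mathcal K,\mathcal B)\ne\mathcal K$. $\mathrm{Ext}(\cdot)$ denotes the set of (nonzero vectors spanning) extreme rays of a cone. A pair $(\mu;\eta_0)\in E\times\mathbb R$ is a valid inequality if $\langle\mu,x\rangle\ge\eta_0$ for all $x\in \mathcal S(A,\mathcal K,\mathcal B)$. $C(A,\mathcal K,\mathcal B)\subset E\times\mathbb R$ is the convex cone of all valid inequalities. A cone-implied inequality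 is one of the form $(\delta;0)$ with $\delta\in\mathcal K^*$. A valid inequality $(\mu;\eta_0)$ with $\mu\neq0$ is $\mathcal K$-minimal if every valid inequality $(\rho;\rho_0)$ with $\rho\ne\mu$ and $\mu-\rho\in\mathcal K^*$ satisfies $\rho_0<\eta_0$. $C_s(A,\mathcal K,\mathcal B)\subset E\times\mathbb R$ is the convex cone of all $(\mu;\eta_0)\in E\times\mathbb R$ satisfying: (A.1) for every $\alpha\in\mathrm{Ext}(\mathcal K^* )$: $0\le\langle\mu,u\rangle$ for all $u\in E$ such that $Au=0$ and $\langle\alpha,v\rangle u+v\in\mathcal K$ for all $v\in\mathrm{Ext}(\mathcal K)$; and (A.2) $\eta_0\le\langle\mu,x\rangle$ for all $x\in\mathcal S(A,\mathcal K,\mathcal B)$. (The members with $\mu\ne0$ are called $\mathcal K$-sublinear inequalities.) Generating sets: for a convex cone $D\subseteq E\times\mathbb R$ let $L_D$ be the largest linear subspace contained in $D$, and $D'=D\cap L_D^\perp$. A generating set of $D$ is a pair $(G,G')$ forming a (inclusionwise) minimal collection of elements with $G\subseteq L_D$, $G'\subseteq D'$ such that $D=\{\sum_{w\in G}\alpha_w w+\sum_{v\in G'}\lambda_v v:\ \alpha_w\in\mathbb R,\ \lambda_v\ge0\}$ (finite sums). For $D=C(A,\mathcal K,\mathcal B)$ write $L=L_D$ and $(G_L,G_C)$ for a generating set. A vector $u$ is an $L$-multiple of $v$ if $u=\tau v+\ell$ with $\tau>0$, $\ell\in L$. $G_C^+$ denotes the set of vectors of $G_C$ that are not $L$-multiples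 of any cone-implied inequality $(\delta;0)$ with $\delta\in\mathcal K^*\setminus\{0\}$. *)

theory Defs
  imports "HOL-Analysis.Analysis"
begin

definition regular_cone :: "'a::euclidean_space set \<Rightarrow> bool" where
  "regular_cone K \<longleftrightarrow>
     closed K \<and> convex_cone K \<and> (\<forall>x. x \<in> K \<and> - x \<in> K \<longrightarrow> x = 0) \<and> interior K \<noteq> {}"

definition dual_cone :: "'a::euclidean_space set \<Rightarrow> 'a set" where
  "dual_cone K = {y. \<forall>x\<in>K. 0 \<le> x \<bullet> y}"

text \<open>All nonzero vectors spanning an extreme ray; no normalisation is imposed.\<close>

definition Ext :: "'a::euclidean_space set \<Rightarrow> 'a set" where
  "Ext K = {x. x \<noteq> 0 \<and> (\<lambda>t. t *\<^sub>R x) ` {0..} face_of K}"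

definition sol_set :: "('a::euclidean_space \<Rightarrow> real^'m) \<Rightarrow> 'a set \<Rightarrow> (real^'m) set \<Rightarrow> 'a set" where
  "sol_set A K B = {x \<in> K. A x \<in> B}"

text \<open>An inequality \<open>\<eta>\<^sub>0 \<le> \<mu> \<bullet> x\<close> is represented by the pair \<open>(\<mu>, \<eta>\<^sub>0)\<close>.\<close>

definition valid_cone ::
    "('a::euclidean_space \<Rightarrow> real^'m) \<Rightarrow> 'a set \<Rightarrow> (real^'m) set \<Rightarrow> ('a \<times> real) set" where
  "valid_cone A K B = {(\<mu>, \<eta>\<^sub>0). \<forall>x\<in>sol_set A K B. \<eta>\<^sub>0 \<le> \<mu> \<bullet> x}"

definition K_minimal ::
    "('a::euclidean_space \<Rightarrow> real^'m) \<Rightarrow> 'a set \<Rightarrow> (real^'m) set \<Rightarrow> 'a \<times> real \<Rightarrow> bool" where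
  "K_minimal A K B = (\<lambda>(\<mu>, \<eta>\<^sub>0).
     (\<mu>, \<eta>\<^sub>0) \<in> valid_cone A K B \<and> \<mu> \<noteq> 0 \<and>
     (\<forall>\<rho> \<rho>\<^sub>0. (\<rho>, \<rho>\<^sub>0) \<in> valid_cone A K B \<and> \<rho> \<noteq> \<mu> \<and> \<mu> - \<rho> \<in> dual_cone K \<longrightarrow> \<rho>\<^sub>0 < \<eta>\<^sub>0))"

definition sublinear_cone ::
    "('a::euclidean_space \<Rightarrow> real^'m) \<Rightarrow> 'a set \<Rightarrow> (real^'m) set \<Rightarrow> ('a \<times> real) set" where
  "sublinear_cone A K B = {(\<mu>, \<eta>\<^sub>0).
     (\<forall>\<alpha>\<in>Ext (dual_cone K). \<forall>u.
        A u = 0 \<and> (\<forall>v\<in>Ext K. (\<alpha> \<bullet> v) *\<^sub>R u + v \<in> K) \<longrightarrow> 0 \<le> \<mu> \<bullet> u) \<and>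
     (\<forall>x\<in>sol_set A K B. \<eta>\<^sub>0 \<le> \<mu> \<bullet> x)}"

text \<open>The largest linear subspace contained in \<open>D\<close>. It exists for every convex cone \<open>D\<close>;
  see \<open>lineality_space_properties\<close> below.\<close>

definition lineality_space :: "'b::real_vector set \<Rightarrow> 'b set" where
  "lineality_space D = (GREATEST L. subspace L \<and> L \<subseteq> D)"

definition generated_set :: "'b::real_vector set \<Rightarrow> 'b set \<Rightarrow> 'b set" where
  "generated_set G G' =
     {(\<Sum>w\<in>F. a w *\<^sub>R w) + (\<Sum>v\<in>F'. c v *\<^sub>R v) | F F' a c.
        finite F \<and> F \<subseteq> G \<and> finite F' \<and> F' \<subseteq> G' \<and> (\<forall>v\<in>F'. 0 \<le> c v)}"

text \<open>Minimality is with respect to componentwise inclusion of pairs.\<close>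

definition generating_set :: "'b::euclidean_space set \<Rightarrow> 'b set \<Rightarrow> 'b set \<Rightarrow> bool" where
  "generating_set D G G' \<longleftrightarrow>
     G \<subseteq> lineality_space D \<and>
     G' \<subseteq> D \<inter> orthogonal_comp (lineality_space D) \<and>
     D = generated_set G G' \<and>
     (\<forall>H H'. H \<subseteq> G \<and> H' \<subseteq> G' \<and> D = generated_set H H' \<longrightarrow> H = G \<and> H' = G')"

definition L_multiple :: "'b::real_vector set \<Rightarrow> 'b \<Rightarrow> 'b \<Rightarrow> bool" where
  "L_multiple L u v \<longleftrightarrow> (\<exists>\<tau> l. 0 < \<tau> \<and> l \<in> L \<and> u = \<tau> *\<^sub>R v + l)"

text \<open>For a generating set \<open>(G\<^sub>L, G\<^sub>C)\<close> of \<open>valid_cone A K B\<close>, this is the set \<open>G\<^sub>C\<^sup>+\<close>.\<close>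

definition non_implied_generators ::
    "('a::euclidean_space \<Rightarrow> real^'m) \<Rightarrow> 'a set \<Rightarrow> (real^'m) set \<Rightarrow>
     ('a \<times> real) set \<Rightarrow> ('a \<times> real) set" where
  "non_implied_generators A K B G\<^sub>C =
     {g \<in> G\<^sub>C. \<not> (\<exists>\<delta>\<in>dual_cone K - {0}. L_multiple (lineality_space (valid_cone A K B)) g (\<delta>, 0))}"

lemma lineality_space_eq:
  assumes "convex_cone D"
  shows "subspace (D \<inter> uminus ` D)" "lineality_space D = D \<inter> uminus ` D"
proof -
  have add: "x + y \<in> D" if "x \<in> D" "y \<in> D" for x y
    using assms that by (rule convex_cone_add)
  have scale: "c *\<^sub>R x \<in> D" if "0 \<le> c" "x \<in> D" for c x
    using assms that by (simp add: convex_cone_scaleR)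
  have zero: "0 \<in> D"
    using assms by (simp add: convex_cone_contains_0)
  have mem: "x \<in> uminus ` D \<longleftrightarrow> - x \<in> D" for x
    by (auto simp: image_iff) (metis minus_minus)
  show sub: "subspace (D \<inter> uminus ` D)"
  proof (rule subspaceI)
    show "0 \<in> D \<inter> uminus ` D" using zero by (simp add: mem)
  next
    fix x y assume "x \<in> D \<inter> uminus ` D" "y \<in> D \<inter> uminus ` D"
    then show "x + y \<in> D \<inter> uminus ` D"
      using add[of x y] add[of "- x" "- y"] by (simp add: mem)
  next
    fix c x assume x: "x \<in> D \<inter> uminus ` D"
    show "c *\<^sub>R x \<in> D \<inter> uminus ` D"
    proof (cases "0 \<le> c")
      case True
      then show ?thesis using x scale[of c x] scale[of c "- x"] by (simp add: mem)
    next
      case False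
      then show ?thesis using x scale[of "- c" x] scale[of "- c" "- x"] by (simp add: mem)
    qed
  qed
  show "lineality_space D = D \<inter> uminus ` D"
    unfolding lineality_space_def
  proof (rule Greatest_equality)
    show "subspace (D \<inter> uminus ` D) \<and> D \<inter> uminus ` D \<subseteq> D" using sub by simp
  next
    fix M :: "'a set" assume M: "subspace M \<and> M \<subseteq> D"
    show "M \<subseteq> D \<inter> uminus ` D"
      using M subspace_neg[of M] by (fastforce simp: mem)
  qed
qed

lemma lineality_space_properties:
  assumes "convex_cone D"
  shows "subspace (lineality_space D)" "lineality_space D \<subseteq> D"
    "subspace M \<Longrightarrow> M \<subseteq> D \<Longrightarrow> M \<subseteq> lineality_space D"
proof -
  show "subspace (lineality_space D)" "lineality_space D \<subseteq> D"
    using lineality_space_eq[OF assms] by auto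
  show "M \<subseteq> lineality_space D" if "subspace M" "M \<subseteq> D"
  proof
    fix x assume "x \<in> M"
    then have "x \<in> D" "- x \<in> D" using that subspace_neg[of M x] by auto
    then show "x \<in> lineality_space D"
      unfolding lineality_space_eq(2)[OF assms] by (metis IntI imageI minus_minus)
  qed
qed

lemma convex_cone_valid_cone: "convex_cone (valid_cone A K B)"
  unfolding convex_cone_iff
  by (auto simp: valid_cone_def inner_add_left zero_prod_def add_mono mult_left_mono)

lemma convex_cone_sublinear_cone: "convex_cone (sublinear_cone A K B)"
  unfolding convex_cone_iff
  by (auto simp: sublinear_cone_def inner_add_left zero_prod_def add_mono mult_left_mono)

end

theory Submission
  imports Defs
begin

text \<open>
  Write \<open>C\<close> for the cone of valid inequalities, \<open>S \<subseteq> C\<close> for the cone of sublinear ones. Both are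
  closed convex cones, and for a closed convex cone \<open>D\<close> with lineality space \<open>L\<close> a generating set is
  nothing but a basis of \<open>L\<close> together with exactly one vector on each extreme ray of the pointed
  cone \<open>D \<inter> L\<^sup>\<bottom>\<close> (\<open>generating_set_iff\<close>). So the theorem compares the lineality spaces and the extreme
  rays of \<open>C\<close> and \<open>S\<close>.

  The comparison rests on one geometric observation. If \<open>(\<mu>, \<eta>)\<close> is valid but violates sublinearity,
  witnessed by an extreme ray \<open>\<alpha>\<close> of the dual cone and a vector \<open>u\<close> with \<open>\<mu> \<bullet> u < 0\<close>, then the shear
  \<open>x \<mapsto> x + (\<alpha> \<bullet> x) u\<close> maps the solution set into itself. Evaluating the inequality at sheared
  solutions shows that \<open>(\<mu> - \<delta>, \<eta>)\<close> is valid for \<open>\<delta> = \<bar>\<mu> \<bullet> u\<bar> \<alpha>\<close>, a nonzero element of the dual cone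
  (\<open>valid_cone_subtract_dual\<close>). The hypothesis that every such \<open>\<delta>\<close> is positive somewhere on the
  solution set says that \<open>(\<delta>, 0)\<close> lies outside the lineality space of \<open>C\<close>. Two things follow.

  \<^item> The lineality spaces agree: an inequality that is tight at every solution cannot remain valid
    after subtracting \<open>\<delta>\<close> (\<open>lineality_space_sublinear_cone\<close>).
  \<^item> An extreme ray of \<open>C\<close> outside \<open>S\<close> splits as \<open>(\<mu> - \<delta>, \<eta>) + (\<delta>, 0)\<close>, so extremality makes it a
    multiple of the cone-implied inequality \<open>(\<delta>, 0)\<close> modulo the lineality space
    (\<open>extreme_valid_sublinear_or_implied\<close>).

  Hence a generating set of \<open>C\<close> can be assembled from the given generators of \<open>S\<close> that are extreme in
  \<open>C\<close>, together with representatives of the extreme rays of \<open>C\<close> outside \<open>S\<close>; modulo the lineality space the latter are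
  implied. Finally, decompose a generator \<open>g\<close> of \<open>S\<close> along these generators of \<open>C\<close>. If implied
  generators contribute a nonzero \<open>\<delta>\<close>, subtracting it shows that \<open>g\<close> is not minimal. Otherwise \<open>g\<close> is
  a combination of non-implied generators; as these lie in \<open>S\<close> and \<open>g\<close> is extreme in \<open>S\<close>, it is one
  of them.
\<close>

section \<open>Extreme rays of convex cones\<close>

text \<open>An algebraic description of extreme rays, closer to the way they are used than the
  definition through faces: every summand of \<open>x\<close> within the cone is a multiple of \<open>x\<close>. Requiring
  \<open>t \<ge> 0\<close> forces the cone to be pointed, as does the existence of an extreme ray.\<close>

lemma Ext_iff:
  assumes P: "convex_cone P"
  shows "x \<in> Ext P \<longleftrightarrow>
    x \<noteq> 0 \<and> x \<in> P \<and> (\<forall>p q. p \<in> P \<and> q \<in> P \<and> p + q = x \<longrightarrow> (\<exists>t\<ge>0. p = t *\<^sub>R x))"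
    (is "_ \<longleftrightarrow> ?rhs")
proof
  assume x: "x \<in> Ext P"
  let ?R = "(\<lambda>t. t *\<^sub>R x) ` {0..}"
  have face: "?R face_of P" and x0: "x \<noteq> 0"
    using x by (auto simp: Ext_def)
  have xR: "x \<in> ?R"
    by (rule image_eqI[of _ _ 1]) auto
  have xP: "x \<in> P"
    using face_of_imp_subset[OF face] xR by blast
  have "\<exists>t\<ge>0. p = t *\<^sub>R x" if pq: "p \<in> P" "q \<in> P" "p + q = x" for p q
  proof (cases "p = q")
    case True
    then have "x = 2 *\<^sub>R p"
      using pq(3) by (metis scaleR_2)
    then have "p = (1/2) *\<^sub>R x" by simp
    then show ?thesis by (intro exI[of _ "1/2"]) simp
  next
    case False
    have "2 *\<^sub>R p \<in> P" "2 *\<^sub>R q \<in> P"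
      using pq convex_cone_scaleR[OF P] by simp_all
    moreover have "x \<in> open_segment (2 *\<^sub>R p) (2 *\<^sub>R q)"
      unfolding in_segment using False pq(3) by (auto intro!: exI[of _ "1/2"])
    \<comment> \<open>\<open>x\<close> is the midpoint of the doubled summands, so the face property applies.\<close>
    ultimately have "2 *\<^sub>R p \<in> ?R"
      using face xR unfolding face_of_def by blast
    then obtain t where t: "0 \<le> t" "2 *\<^sub>R p = t *\<^sub>R x" by auto
    have "p = (1/2) *\<^sub>R (2 *\<^sub>R p)" by simp
    also have "\<dots> = (t/2) *\<^sub>R x" unfolding t(2) by simp
    finally have "p = (t/2) *\<^sub>R x" .
    then show ?thesis using t by (intro exI[of _ "t/2"]) simp
  qed
  then show ?rhs using x0 xP by blast
next
  assume rhs: ?rhs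
  then have x0: "x \<noteq> 0" and xP: "x \<in> P"
    and ext: "\<And>p q. p \<in> P \<Longrightarrow> q \<in> P \<Longrightarrow> p + q = x \<Longrightarrow> \<exists>t\<ge>0. p = t *\<^sub>R x"
    by blast+
  let ?R = "(\<lambda>t. t *\<^sub>R x) ` {0..}"
  \<comment> \<open>If the cone contained the line of \<open>y\<close>, both \<open>y\<close> and \<open>- y\<close> would be summands of \<open>x\<close>, hence
    nonnegative multiples of it.\<close>
  have pointed: "y = 0" if y: "y \<in> P" "- y \<in> P" for y
  proof -
    have "x - y \<in> P" "x + y \<in> P"
      using convex_cone_add[OF P xP y(2)] convex_cone_add[OF P xP y(1)] by simp_all
    then obtain s t where s: "0 \<le> s" "y = s *\<^sub>R x" and t: "0 \<le> t" "- y = t *\<^sub>R x"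
      using ext[of y "x - y"] ext[of "- y" "x + y"] y by auto
    then have "(s + t) *\<^sub>R x = 0" by (simp add: scaleR_add_left flip: s(2) t(2))
    then show "y = 0" using x0 s t by auto
  qed
  have endpoint: "a \<in> ?R"
    if a: "a \<in> P" and b: "b \<in> P" and u: "0 < u" "0 < v"
      and s: "0 \<le> s" "s *\<^sub>R x = u *\<^sub>R a + v *\<^sub>R b" for a b u v s
  proof (cases "s = 0")
    case True
    then have "u *\<^sub>R a = - (v *\<^sub>R b)" using s(2) by (simp add: add_eq_0_iff2)
    then have "u *\<^sub>R a = 0"
      using pointed[of "u *\<^sub>R a"] convex_cone_scaleR[OF P, of u a] convex_cone_scaleR[OF P, of v b] a b u
      by simp
    then show ?thesis using u by (intro image_eqI[of _ _ 0]) auto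
  next
    case False
    then have s0: "0 < s" using s by simp
    have "(u/s) *\<^sub>R a + (v/s) *\<^sub>R b = (1/s) *\<^sub>R (s *\<^sub>R x)"
      unfolding s(2) by (simp add: scaleR_add_right)
    also have "\<dots> = x" using s0 by simp
    finally have sum: "(u/s) *\<^sub>R a + (v/s) *\<^sub>R b = x" .
    have "(u/s) *\<^sub>R a \<in> P" "(v/s) *\<^sub>R b \<in> P"
      using convex_cone_scaleR[OF P] a b u s0 by simp_all
    then obtain t where t: "0 \<le> t" "(u/s) *\<^sub>R a = t *\<^sub>R x"
      using ext sum by blast
    have "a = (s/u) *\<^sub>R ((u/s) *\<^sub>R a)" using s0 u by simp
    also have "\<dots> = (s/u * t) *\<^sub>R x" unfolding t(2) by simp
    finally show ?thesis using t s0 u by (intro image_eqI[of _ _ "s/u * t"]) auto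
  qed
  have "?R face_of P"
    unfolding face_of_def
  proof (intro conjI ballI impI)
    show "?R \<subseteq> P" using convex_cone_scaleR[OF P] xP by auto
    have "linear (\<lambda>t. t *\<^sub>R x)" by (simp add: linear_iff scaleR_add_left)
    then show "convex ?R" by (rule convex_linear_image) (rule convex_real_interval)
  next
    fix a b y
    assume ab: "a \<in> P" "b \<in> P" and "y \<in> ?R" "y \<in> open_segment a b"
    then obtain s u where s: "0 \<le> s" and u: "0 < u" "u < 1"
      and e: "s *\<^sub>R x = (1 - u) *\<^sub>R a + u *\<^sub>R b"
      unfolding in_segment by auto
    show "a \<in> ?R" using endpoint[OF ab, of "1-u" u s] s u e by simp
    show "b \<in> ?R" using endpoint[OF ab(2,1), of u "1-u" s] s u e by (simp add: add.commute)
  qed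
  then show "x \<in> Ext P" using x0 by (simp add: Ext_def)
qed

lemma Ext_subset: "convex_cone P \<Longrightarrow> Ext P \<subseteq> P"
  by (auto simp: Ext_iff)

lemma Ext_scaleR:
  assumes "x \<in> Ext P" "0 < c"
  shows "c *\<^sub>R x \<in> Ext P"
proof -
  have "(\<lambda>t. t *\<^sub>R c *\<^sub>R x) ` {0..} = (\<lambda>t. t *\<^sub>R x) ` {0..}"
  proof (intro subset_antisym subsetI; elim imageE)
    fix y t assume "y = t *\<^sub>R c *\<^sub>R x" "t \<in> {0..}"
    then show "y \<in> (\<lambda>t. t *\<^sub>R x) ` {0..}"
      using assms(2) by (intro image_eqI[of _ _ "t * c"]) auto
  next
    fix y t assume "y = t *\<^sub>R x" "t \<in> {0..}"
    then show "y \<in> (\<lambda>t. t *\<^sub>R c *\<^sub>R x) ` {0..}"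
      using assms(2) by (intro image_eqI[of _ _ "t / c"]) auto
  qed
  then show ?thesis using assms by (simp add: Ext_def)
qed

lemma Ext_subcone:
  assumes "convex_cone P" "convex_cone Q" "Q \<subseteq> P" "x \<in> Ext P" "x \<in> Q"
  shows "x \<in> Ext Q"
proof -
  have "\<exists>t\<ge>0. p = t *\<^sub>R x" if "p \<in> Q" "q \<in> Q" "p + q = x" for p q
    using assms(3,4) that unfolding Ext_iff[OF assms(1)] by blast
  moreover have "x \<noteq> 0" using assms(4) by (simp add: Ext_def)
  ultimately show ?thesis unfolding Ext_iff[OF assms(2)] using assms(5) by blast
qed

text \<open>Removing an open extreme ray from a convex cone leaves a convex cone, which cannot contain
  every generator.\<close>

lemma generators_meet_Ext:
  assumes P: "convex_cone P" and hull: "convex_cone hull R = P" and x: "x \<in> Ext P"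
  shows "\<exists>c>0. c *\<^sub>R x \<in> R"
proof (rule ccontr)
  assume none: "\<not> (\<exists>c>0. c *\<^sub>R x \<in> R)"
  let ?Q = "{p \<in> P. \<forall>c>0. p \<noteq> c *\<^sub>R x}"
  have x0: "x \<noteq> 0" using x by (simp add: Ext_def)
  have "p + q \<in> ?Q" if p: "p \<in> ?Q" and q: "q \<in> ?Q" for p q
  proof (rule ccontr)
    assume "p + q \<notin> ?Q"
    then obtain c where c: "0 < c" "p + q = c *\<^sub>R x"
      using p q convex_cone_add[OF P] by blast
    have cx: "c *\<^sub>R x \<in> Ext P" using Ext_scaleR x c by blast
    have summand: "\<exists>t\<ge>0. p' = t *\<^sub>R (c *\<^sub>R x)" if "p' \<in> P" "q' \<in> P" "p' + q' = c *\<^sub>R x" for p' q'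
      using cx that unfolding Ext_iff[OF P] by blast
    have "p \<in> P" "q \<in> P" "q + p = c *\<^sub>R x"
      using p q c(2) by (simp_all add: add.commute)
    then obtain s t where s: "0 \<le> s" "p = s *\<^sub>R (c *\<^sub>R x)" and t: "0 \<le> t" "q = t *\<^sub>R (c *\<^sub>R x)"
      using summand[of p q] summand[of q p] c(2) by blast
    have "p = (s * c) *\<^sub>R x" "q = (t * c) *\<^sub>R x"
      using s(2) t(2) by simp_all
    then have "\<not> 0 < s * c" "\<not> 0 < t * c"
      using p q by blast+
    then have "s = 0" "t = 0"
      using s(1) t(1) c(1) by (simp_all add: zero_less_mult_iff)
    then have "p = 0" "q = 0" using s(2) t(2) by simp_all
    then show False using c x0 by simp
  qed
  moreover have "a *\<^sub>R p \<in> ?Q" if p: "p \<in> ?Q" and a: "0 \<le> a" for p a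
  proof (cases "a = 0")
    case True
    then show ?thesis using x0 convex_cone_contains_0[OF P] by auto
  next
    case False
    have "a *\<^sub>R p \<noteq> c *\<^sub>R x" if c: "0 < c" for c
    proof
      assume "a *\<^sub>R p = c *\<^sub>R x"
      then have "(1 / a) *\<^sub>R (a *\<^sub>R p) = (c / a) *\<^sub>R x" by simp
      then have "p = (c / a) *\<^sub>R x" using False by simp
      moreover have "0 < c / a" using a False c by simp
      ultimately show False using p by blast
    qed
    moreover have "a *\<^sub>R p \<in> P" using p convex_cone_scaleR[OF P a] by simp
    ultimately show ?thesis by simp
  qed
  moreover have "0 \<in> ?Q"
    using x0 convex_cone_contains_0[OF P] by auto
  ultimately have "convex_cone ?Q"
    unfolding convex_cone_iff by (intro conjI ballI allI impI)
  moreover have "R \<subseteq> ?Q"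
  proof
    fix r assume r: "r \<in> R"
    then have "r \<in> P" using hull_inc[of r R convex_cone] by (simp only: hull)
    then show "r \<in> ?Q" using none r by auto
  qed
  ultimately have "P \<subseteq> ?Q"
    using hull_minimal[of R ?Q convex_cone] unfolding hull by blast
  then have "x \<in> ?Q" using x Ext_subset[OF P] by blast
  then have "\<forall>c>0. x \<noteq> c *\<^sub>R x" by simp
  then have "x \<noteq> 1 *\<^sub>R x" using zero_less_one by (elim allE[of _ 1] impE)
  then show False by simp
qed

text \<open>The unit vectors of a pointed cone have a convex hull that misses the origin, so a hyperplane
  separates the two; compactness makes the functional uniformly positive. The bound is what makes
  the slice \<open>w \<bullet> x = 1\<close> of the cone bounded.\<close>

lemma pointed_cone_positive_functional:
  fixes P :: "'b::euclidean_space set"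
  assumes "closed P" and P: "convex_cone P" and pointed: "\<And>x. x \<in> P \<Longrightarrow> - x \<in> P \<Longrightarrow> x = 0"
  shows "\<exists>w. \<exists>b>0. \<forall>x\<in>P. b * norm x \<le> w \<bullet> x"
proof -
  let ?S = "P \<inter> sphere 0 1"
  have scale: "\<And>c x. 0 \<le> c \<Longrightarrow> x \<in> P \<Longrightarrow> c *\<^sub>R x \<in> P"
    by (rule convex_cone_scaleR[OF P])
  have "compact ?S" using assms(1) by (simp add: closed_Int_compact)
  then have closed: "closed (convex hull ?S)"
    by (intro compact_imp_closed compact_convex_hull)
  have "convex (P - {0})"
    unfolding convex_def
  proof (intro ballI allI impI DiffI)
    fix x y :: 'b and u v :: real
    assume x: "x \<in> P - {0}" and y: "y \<in> P - {0}" and u: "0 \<le> u" and v: "0 \<le> v" and uv: "u + v = 1"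
    show "u *\<^sub>R x + v *\<^sub>R y \<in> P"
      using x y by (intro convex_cone_add[OF P] scale u v) simp_all
    show "u *\<^sub>R x + v *\<^sub>R y \<notin> {0}"
    proof
      assume "u *\<^sub>R x + v *\<^sub>R y \<in> {0}"
      then have eq: "- (u *\<^sub>R x) = v *\<^sub>R y" by (simp add: minus_unique)
      then have "u *\<^sub>R x = 0"
        using pointed[of "u *\<^sub>R x"] scale[OF u, of x] scale[OF v, of y] x y by simp
      then show False using eq x y uv by auto
    qed
  qed
  then have "convex hull ?S \<subseteq> P - {0}"
    by (intro hull_minimal) auto
  then have "0 \<notin> convex hull ?S" by blast
  then obtain w b where b: "0 < b" and w: "\<forall>x\<in>convex hull ?S. w \<bullet> x > b"
    using separating_hyperplane_closed_0[OF convex_convex_hull closed] by blast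
  have "b * norm x \<le> w \<bullet> x" if x: "x \<in> P" for x
  proof (cases "x = 0")
    case False
    have "(1 / norm x) *\<^sub>R x \<in> ?S" using scale[OF _ x, of "1 / norm x"] False by simp
    then have "b < w \<bullet> ((1 / norm x) *\<^sub>R x)" by (intro bspec[OF w] hull_inc)
    then show ?thesis using False by (simp add: field_simps)
  qed simp
  then show ?thesis using b by (intro exI[of _ w] exI[of _ b] conjI ballI)
qed

text \<open>The conic form of Minkowski's theorem. The slice \<open>w \<bullet> x = 1\<close> is compact, hence the convex
  hull of its extreme points, and these span extreme rays of the cone. Only representatives of the
  rays are demanded of \<open>R\<close>, so that the lemma also applies after discarding generators.\<close>

lemma pointed_closed_cone_hull:
  fixes P :: "'b::euclidean_space set"
  assumes cl: "closed P" and P: "convex_cone P" and pointed: "\<And>x. x \<in> P \<Longrightarrow> - x \<in> P \<Longrightarrow> x = 0"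
    and R: "R \<subseteq> P" "\<And>x. x \<in> Ext P \<Longrightarrow> \<exists>c>0. c *\<^sub>R x \<in> R"
  shows "convex_cone hull R = P"
proof
  show "convex_cone hull R \<subseteq> P" using R(1) P by (rule hull_minimal)
  obtain w b where b: "0 < b" and wb: "\<forall>x\<in>P. b * norm x \<le> w \<bullet> x"
    using pointed_cone_positive_functional[OF cl P pointed] by blast
  note w = bspec[OF wb]
  have scale: "\<And>c x. 0 \<le> c \<Longrightarrow> x \<in> P \<Longrightarrow> c *\<^sub>R x \<in> P"
    by (rule convex_cone_scaleR[OF P])
  have wpos: "0 < w \<bullet> x" if "x \<in> P" "x \<noteq> 0" for x
    using w[OF that(1)] b that(2) by (smt (verit) mult_pos_pos zero_less_norm_iff)
  let ?S = "P \<inter> {x. w \<bullet> x = 1}"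
  have "norm x \<le> 1 / b" if "x \<in> ?S" for x
    using w[of x] that b by (simp add: field_simps)
  then have "bounded ?S" unfolding bounded_iff by blast
  moreover have "closed ?S" using cl by (intro closed_Int closed_hyperplane)
  ultimately have S: "?S = convex hull {x. x extreme_point_of ?S}"
    using P by (intro Krein_Milman_Minkowski)
      (auto simp: compact_eq_bounded_closed convex_cone_def intro!: convex_Int convex_hyperplane)
  have ext: "x \<in> Ext P" if x: "x extreme_point_of ?S" for x
  proof -
    have xP: "x \<in> P" and wx: "w \<bullet> x = 1" using x by (auto simp: extreme_point_of_def)
    have "\<exists>t\<ge>0. p = t *\<^sub>R x" if p: "p \<in> P" and q: "q \<in> P" and pq: "p + q = x" for p q
    proof (cases "p = 0 \<or> q = 0")
      case True
      then show ?thesis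
        using pq by (metis add.right_neutral order_refl scaleR_one scaleR_zero_left zero_le_one)
    next
      case False
      let ?s = "w \<bullet> p" and ?t = "w \<bullet> q"
      have s: "0 < ?s" and t: "0 < ?t" using wpos p q False by auto
      have st: "?s + ?t = 1" using wx pq by (metis inner_add_right)
      have "p /\<^sub>R ?s \<in> ?S" "q /\<^sub>R ?t \<in> ?S"
        using p q s t scale by auto
      \<comment> \<open>Rescaled to the slice, the summands have \<open>x\<close> as a convex combination; extremality of \<open>x\<close>
        makes them coincide.\<close>
      moreover have conv: "x = (1 - ?t) *\<^sub>R (p /\<^sub>R ?s) + ?t *\<^sub>R (q /\<^sub>R ?t)"
      proof -
        have "1 - ?t = ?s" using st by simp
        then show ?thesis using s t pq by simp
      qed
      ultimately have "p /\<^sub>R ?s = q /\<^sub>R ?t"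
        using x s t st unfolding extreme_point_of_def in_segment by (smt (verit))
      then have "x = (1 - ?t + ?t) *\<^sub>R (p /\<^sub>R ?s)"
        using conv by (simp only: scaleR_add_left)
      then have "x = p /\<^sub>R ?s" by simp
      then have "p = ?s *\<^sub>R x" using s by simp
      then show ?thesis using s less_imp_le by blast
    qed
    moreover have "x \<noteq> 0" using wx by auto
    ultimately show ?thesis unfolding Ext_iff[OF P] using xP by blast
  qed
  have "x \<in> convex_cone hull R" if "x \<in> Ext P" for x
  proof -
    obtain c where c: "0 < c" "c *\<^sub>R x \<in> R" using R(2) \<open>x \<in> Ext P\<close> by blast
    then have "(1 / c) *\<^sub>R (c *\<^sub>R x) \<in> convex_cone hull R"
      by (intro convex_cone_hull_mul hull_inc) auto
    then show ?thesis using c by simp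
  qed
  then have "?S \<subseteq> convex_cone hull R"
    using ext by (subst S, intro hull_minimal convex_convex_cone_hull) auto
  then show "P \<subseteq> convex_cone hull R"
  proof (intro subsetI)
    fix x assume sub: "?S \<subseteq> convex_cone hull R" and x: "x \<in> P"
    show "x \<in> convex_cone hull R"
    proof (cases "x = 0")
      case False
      then have wx: "0 < w \<bullet> x" using wpos x by blast
      then have "x /\<^sub>R (w \<bullet> x) \<in> convex_cone hull R" using sub scale x by auto
      then have "(w \<bullet> x) *\<^sub>R (x /\<^sub>R (w \<bullet> x)) \<in> convex_cone hull R"
        by (rule convex_cone_hull_mul) (use wx in simp)
      then show ?thesis using wx by simp
    qed (simp add: convex_cone_hull_contains_0)
  qed
qed

section \<open>Generating sets\<close>

lemma generated_set_eq_span_plus_hull: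
  "generated_set G G' = {x + y | x y. x \<in> span G \<and> y \<in> convex_cone hull G'}"
proof -
  let ?N = "{\<Sum>v\<in>F. c v *\<^sub>R v | F c. finite F \<and> F \<subseteq> G' \<and> (\<forall>v\<in>F. 0 \<le> c v)}"
  have "convex_cone hull G' = ?N"
  proof
    show "?N \<subseteq> convex_cone hull G'"
    proof clarify
      fix F and c :: "'a \<Rightarrow> real"
      assume "finite F" "F \<subseteq> G'" "\<forall>v\<in>F. 0 \<le> c v"
      then show "(\<Sum>v\<in>F. c v *\<^sub>R v) \<in> convex_cone hull G'"
        by (induction F rule: finite_induct)
          (auto intro: convex_cone_hull_add convex_cone_hull_mul hull_inc convex_cone_hull_contains_0)
    qed
    show "convex_cone hull G' \<subseteq> ?N"
    proof
      fix y assume "y \<in> convex_cone hull G'"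
      then consider "y = 0" | x c where "x \<in> convex hull G'" "0 \<le> c" "y = c *\<^sub>R x"
        unfolding convex_cone_hull_convex_hull by auto
      then show "y \<in> ?N"
      proof cases
        case 1
        show ?thesis unfolding 1 mem_Collect_eq
          by (rule exI[of _ "{}"]) simp
      next
        case 2
        then obtain F u where F: "finite F" "F \<subseteq> G'" "\<forall>v\<in>F. 0 \<le> u v" "(\<Sum>v\<in>F. u v *\<^sub>R v) = x"
          unfolding convex_hull_explicit by auto
        have "y = (\<Sum>v\<in>F. (c * u v) *\<^sub>R v)"
          unfolding 2(3) F(4)[symmetric] by (simp add: scaleR_sum_right)
        then show ?thesis using F 2(2) unfolding mem_Collect_eq
          by (intro exI[of _ F] exI[of _ "\<lambda>v. c * u v"]) simp
      qed
    qed
  qed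
  then show ?thesis
    unfolding generated_set_def span_explicit by fastforce
qed

definition pointed_part :: "'b::euclidean_space set \<Rightarrow> 'b set" where
  "pointed_part D = D \<inter> orthogonal_comp (lineality_space D)"

lemma lineality_decomposition:
  assumes D: "convex_cone D" and x: "x \<in> D"
  obtains l p where "l \<in> lineality_space D" "p \<in> pointed_part D" "x = l + p"
proof -
  obtain l p where l: "l \<in> span (lineality_space D)" and o: "\<And>w. w \<in> span (lineality_space D) \<Longrightarrow> orthogonal p w"
    and e: "x = l + p"
    using orthogonal_subspace_decomp_exists[of "lineality_space D" x] by blast
  have L: "subspace (lineality_space D)" using lineality_space_properties[OF D] by blast
  then have lL: "l \<in> lineality_space D" using l by (simp add: span_eq_iff[THEN iffD2])
  then have "- l \<in> D"
    using lineality_space_properties(2)[OF D] subspace_neg[OF L] by blast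
  then have "p \<in> D" using convex_cone_add[OF D x] e by fastforce
  moreover have "p \<in> orthogonal_comp (lineality_space D)"
    using o by (auto simp: orthogonal_comp_def orthogonal_commute span_base)
  ultimately show ?thesis using that lL e unfolding pointed_part_def by blast
qed

lemma orthogonal_decomposition_unique:
  assumes L: "subspace L" and "l \<in> L" "l' \<in> L" "p \<in> orthogonal_comp L" "p' \<in> orthogonal_comp L"
    and e: "l + p = l' + p'"
  shows "l = l'" "p = p'"
proof -
  have "l - l' \<in> L" "p' - p \<in> orthogonal_comp L"
    using assms by (auto intro: subspace_diff subspace_orthogonal_comp)
  moreover have "l - l' = p' - p" using e by (simp add: algebra_simps)
  ultimately have "(l - l') \<bullet> (l - l') = 0"
    by (auto simp: orthogonal_comp_def orthogonal_def)
  then show "l = l'" by simp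
  then show "p = p'" using e by simp
qed

lemma convex_cone_pointed_part: "convex_cone D \<Longrightarrow> convex_cone (pointed_part D)"
  unfolding pointed_part_def
  using subspace_imp_convex_cone[OF subspace_orthogonal_comp[of "lineality_space D"]]
  by (auto simp: convex_cone_iff)

lemma pointed_part_pointed:
  assumes D: "convex_cone D" and "x \<in> pointed_part D" "- x \<in> pointed_part D"
  shows "x = 0"
proof -
  have "- (- x) \<in> uminus ` D" using assms unfolding pointed_part_def by blast
  then have "x \<in> lineality_space D"
    using assms unfolding lineality_space_eq(2)[OF D] pointed_part_def by auto
  then show ?thesis using assms unfolding pointed_part_def orthogonal_comp_def orthogonal_def by auto
qed

text \<open>The two components of a generating pair live in complementary orthogonal subspaces, so they
  can be treated independently: one has to span the lineality space, the other to generate the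
  pointed part.\<close>

lemma generated_set_eq_iff:
  assumes D: "convex_cone D" and G: "G \<subseteq> lineality_space D" and G': "G' \<subseteq> pointed_part D"
  shows "D = generated_set G G' \<longleftrightarrow>
    span G = lineality_space D \<and> convex_cone hull G' = pointed_part D"
proof -
  let ?L = "lineality_space D" and ?P = "pointed_part D"
  note L = lineality_space_properties(1,2)[OF D]
  have spG: "span G \<subseteq> ?L" using G L(1) by (rule span_minimal)
  have hG: "convex_cone hull G' \<subseteq> ?P"
    using G' convex_cone_pointed_part[OF D] by (rule hull_minimal)
  have P0: "0 \<in> ?P" using convex_cone_contains_0 convex_cone_pointed_part[OF D] by blast
  have PD: "?P \<subseteq> D" "?P \<subseteq> orthogonal_comp ?L" by (auto simp: pointed_part_def)
  show ?thesis
  proof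
    assume eq: "D = generated_set G G'"
    have *: "l \<in> span G \<and> p \<in> convex_cone hull G'" if "l \<in> ?L" "p \<in> ?P" for l p
    proof -
      have "l + p \<in> D" using that L PD convex_cone_add[OF D] by blast
      then obtain x y where xy: "l + p = x + y" "x \<in> span G" "y \<in> convex_cone hull G'"
        unfolding eq generated_set_eq_span_plus_hull by auto
      have "l = x" "p = y"
        using orthogonal_decomposition_unique[OF L(1) that(1) _ _ _ xy(1)] xy spG hG PD that by blast+
      then show ?thesis using xy by simp
    qed
    have "?L \<subseteq> span G" using * P0 by blast
    moreover have "?P \<subseteq> convex_cone hull G'" using * subspace_0[OF L(1)] by blast
    ultimately show "span G = ?L \<and> convex_cone hull G' = ?P" using spG hG by blast
  next
    assume eq: "span G = ?L \<and> convex_cone hull G' = ?P"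
    show "D = generated_set G G'"
      unfolding generated_set_eq_span_plus_hull eq[THEN conjunct1] eq[THEN conjunct2]
    proof (intro subset_antisym subsetI)
      fix x assume "x \<in> D"
      then show "x \<in> {x + y |x y. x \<in> ?L \<and> y \<in> ?P}"
        using lineality_decomposition[OF D] by blast
    next
      fix x assume "x \<in> {x + y |x y. x \<in> ?L \<and> y \<in> ?P}"
      then show "x \<in> D" using L PD convex_cone_add[OF D] by blast
    qed
  qed
qed

definition ray_transversal :: "'b::euclidean_space set \<Rightarrow> 'b set \<Rightarrow> bool" where
  "ray_transversal P R \<longleftrightarrow> R \<subseteq> Ext P \<and> (\<forall>x\<in>Ext P. \<exists>!c. 0 < c \<and> c *\<^sub>R x \<in> R)"

lemma ray_transversal_unique:
  assumes "ray_transversal P R" "r \<in> R" "0 < c" "c *\<^sub>R r \<in> R"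
  shows "c *\<^sub>R r = r"
proof -
  have "\<exists>!c. 0 < c \<and> c *\<^sub>R r \<in> R" using assms(1,2) unfolding ray_transversal_def by blast
  then have "c = 1" using assms(2-4) by (metis scaleR_one zero_less_one)
  then show ?thesis by simp
qed

lemma ray_transversalI:
  assumes "R \<subseteq> Ext P" "\<And>x. x \<in> Ext P \<Longrightarrow> \<exists>c>0. c *\<^sub>R x \<in> R"
    and un: "\<And>r c. r \<in> R \<Longrightarrow> 0 < c \<Longrightarrow> c *\<^sub>R r \<in> R \<Longrightarrow> c *\<^sub>R r = r"
  shows "ray_transversal P R"
  unfolding ray_transversal_def
proof (intro conjI ballI)
  fix x assume x: "x \<in> Ext P"
  then have x0: "x \<noteq> 0" by (simp add: Ext_def)
  obtain c where c: "0 < c" "c *\<^sub>R x \<in> R" using assms(2)[OF x] by blast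
  show "\<exists>!c. 0 < c \<and> c *\<^sub>R x \<in> R"
  proof (rule ex1I[of _ c])
    fix d assume d: "0 < d \<and> d *\<^sub>R x \<in> R"
    then have "(d / c) *\<^sub>R (c *\<^sub>R x) = c *\<^sub>R x"
      using un[OF c(2), of "d / c"] c by simp
    then show "d = c" using c x0 by simp
  qed (use c in simp)
qed (fact assms(1))

text \<open>Every generating system meets every extreme ray, and any system meeting every extreme ray
  generates. So minimality amounts to excluding vectors off the extreme rays and second
  representatives of the same ray.\<close>

lemma minimal_generators_iff_ray_transversal:
  fixes P :: "'b::euclidean_space set"
  assumes cl: "closed P" and P: "convex_cone P" and pointed: "\<And>x. x \<in> P \<Longrightarrow> - x \<in> P \<Longrightarrow> x = 0"
  shows "R \<subseteq> P \<and> convex_cone hull R = P \<and>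
      (\<forall>H\<subseteq>R. convex_cone hull H = P \<longrightarrow> H = R) \<longleftrightarrow> ray_transversal P R"
proof
  assume as: "R \<subseteq> P \<and> convex_cone hull R = P \<and> (\<forall>H\<subseteq>R. convex_cone hull H = P \<longrightarrow> H = R)"
  then have RP: "R \<subseteq> P" and hull: "convex_cone hull R = P"
    and minimal: "\<And>H. H \<subseteq> R \<Longrightarrow> convex_cone hull H = P \<Longrightarrow> H = R"
    by blast+
  have rep: "\<exists>c>0. c *\<^sub>R x \<in> R" if "x \<in> Ext P" for x
    using generators_meet_Ext[OF P hull that] .
  have "R \<inter> Ext P = R"
  proof (rule minimal)
    show "convex_cone hull (R \<inter> Ext P) = P"
      using RP rep Ext_scaleR by (intro pointed_closed_cone_hull[OF cl P pointed]) blast+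
  qed blast
  then have RE: "R \<subseteq> Ext P" by blast
  show "ray_transversal P R"
  proof (rule ray_transversalI[OF RE rep])
    fix r c assume r: "r \<in> R" and c: "(0::real) < c" "c *\<^sub>R r \<in> R"
    show "c *\<^sub>R r = r"
    proof (rule ccontr)
      assume ne: "c *\<^sub>R r \<noteq> r"
      have "\<exists>d>0. d *\<^sub>R x \<in> R - {r}" if x: "x \<in> Ext P" for x
      proof -
        obtain d where d: "0 < d" "d *\<^sub>R x \<in> R" using rep x by blast
        show ?thesis
        proof (cases "d *\<^sub>R x = r")
          case True
          then have "(c * d) *\<^sub>R x \<in> R - {r}" using c ne by (simp flip: scaleR_scaleR)
          then show ?thesis using c d by (metis mult_pos_pos)
        qed (use d in blast)
      qed
      then have "convex_cone hull (R - {r}) = P"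
        using RP by (intro pointed_closed_cone_hull[OF cl P pointed]) blast+
      then have "R - {r} = R" by (intro minimal) blast+
      then show False using r by blast
    qed
  qed
next
  assume t: "ray_transversal P R"
  then have RE: "R \<subseteq> Ext P" and rep: "\<And>x. x \<in> Ext P \<Longrightarrow> \<exists>c>0. c *\<^sub>R x \<in> R"
    unfolding ray_transversal_def by blast+
  have RP: "R \<subseteq> P" using RE Ext_subset[OF P] by blast
  have "convex_cone hull R = P"
    using RP rep by (intro pointed_closed_cone_hull[OF cl P pointed])
  moreover have "H = R" if H: "H \<subseteq> R" "convex_cone hull H = P" for H
  proof (intro subset_antisym subsetI)
    fix r assume r: "r \<in> R"
    then obtain c where c: "0 < c" "c *\<^sub>R r \<in> H"
      using generators_meet_Ext[OF P H(2)] RE by blast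
    then have "c *\<^sub>R r = r" using ray_transversal_unique[OF t r] H(1) by blast
    then show "r \<in> H" using c by simp
  qed (use H in blast)
  ultimately show "R \<subseteq> P \<and> convex_cone hull R = P \<and> (\<forall>H\<subseteq>R. convex_cone hull H = P \<longrightarrow> H = R)"
    using RP by blast
qed

lemma generating_set_iff:
  assumes cl: "closed D" and D: "convex_cone D"
  shows "generating_set D G G' \<longleftrightarrow>
    span G = lineality_space D \<and> (\<forall>H\<subseteq>G. span H = lineality_space D \<longrightarrow> H = G) \<and>
    ray_transversal (pointed_part D) G'"
proof -
  let ?L = "lineality_space D" and ?P = "pointed_part D"
  have clP: "closed ?P"
    unfolding pointed_part_def using cl closed_subspace[OF subspace_orthogonal_comp] by blast
  let ?cond = "\<lambda>H H'. span H = ?L \<and> convex_cone hull H' = ?P"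
  have "generating_set D G G' \<longleftrightarrow> G \<subseteq> ?L \<and> G' \<subseteq> ?P \<and> ?cond G G' \<and>
    (\<forall>H H'. H \<subseteq> G \<and> H' \<subseteq> G' \<and> ?cond H H' \<longrightarrow> H = G \<and> H' = G')"
  proof (cases "G \<subseteq> ?L \<and> G' \<subseteq> ?P")
    case True
    have "D = generated_set H H' \<longleftrightarrow> ?cond H H'" if "H \<subseteq> G" "H' \<subseteq> G'" for H H'
      by (rule generated_set_eq_iff[OF D]) (use that True in blast)+
    then have "(H \<subseteq> G \<and> H' \<subseteq> G' \<and> D = generated_set H H') = (H \<subseteq> G \<and> H' \<subseteq> G' \<and> ?cond H H')"
      and "D = generated_set G G' \<longleftrightarrow> ?cond G G'" for H H'
      by blast+
    then show ?thesis
      unfolding generating_set_def pointed_part_def[symmetric] by simp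
  qed (auto simp: generating_set_def pointed_part_def)
  also have "\<dots> \<longleftrightarrow> span G = ?L \<and> (\<forall>H\<subseteq>G. span H = ?L \<longrightarrow> H = G) \<and>
    (G' \<subseteq> ?P \<and> convex_cone hull G' = ?P \<and> (\<forall>H\<subseteq>G'. convex_cone hull H = ?P \<longrightarrow> H = G'))"
    (is "?lhs \<longleftrightarrow> ?rhs")
  proof
    assume lhs: ?lhs
    then have all: "\<forall>H H'. H \<subseteq> G \<and> H' \<subseteq> G' \<and> ?cond H H' \<longrightarrow> H = G \<and> H' = G'"
      by (elim conjE)
    have m: "H \<subseteq> G \<Longrightarrow> H' \<subseteq> G' \<Longrightarrow> ?cond H H' \<Longrightarrow> H = G \<and> H' = G'" for H H'
      using spec[OF spec[OF all, of H], of H'] by simp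
    show ?rhs using lhs m[of _ G'] m[of G] by simp
  next
    assume ?rhs
    then show ?lhs using span_superset[of G] by simp
  qed
  also have "\<dots> \<longleftrightarrow> span G = ?L \<and> (\<forall>H\<subseteq>G. span H = ?L \<longrightarrow> H = G) \<and> ray_transversal ?P G'"
    using minimal_generators_iff_ray_transversal[OF clP convex_cone_pointed_part[OF D]]
      pointed_part_pointed[OF D] by simp
  finally show ?thesis .
qed

lemma ray_transversal_exists:
  "\<exists>R. ray_transversal P R"
proof -
  \<comment> \<open>The choice depends only on the set of positive multiples of \<open>x\<close>, thus only on the ray.\<close>
  define rep where "rep x = (SOME y. \<exists>c>0. y = c *\<^sub>R x)" for x :: 'a
  have rep: "\<exists>c>0. rep x = c *\<^sub>R x" for x
    unfolding rep_def by (rule someI[of _ x]) (auto intro: exI[of _ 1])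
  have rep_scale: "rep (c *\<^sub>R x) = rep x" if "0 < c" for c x
  proof -
    have "(\<exists>d>0. y = d *\<^sub>R c *\<^sub>R x) \<longleftrightarrow> (\<exists>d>0. y = d *\<^sub>R x)" for y
    proof
      assume "\<exists>d>0. y = d *\<^sub>R c *\<^sub>R x"
      then show "\<exists>d>0. y = d *\<^sub>R x" using that by (metis mult_pos_pos scaleR_scaleR)
    next
      assume "\<exists>d>0. y = d *\<^sub>R x"
      then obtain d where "0 < d" "y = d *\<^sub>R x" by blast
      then show "\<exists>d>0. y = d *\<^sub>R c *\<^sub>R x" using that by (intro exI[of _ "d / c"]) simp
    qed
    then show ?thesis unfolding rep_def by simp
  qed
  have "ray_transversal P (rep ` Ext P)"
  proof (rule ray_transversalI)
    show "rep ` Ext P \<subseteq> Ext P" using rep Ext_scaleR by (metis image_subsetI)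
    show "\<exists>c>0. c *\<^sub>R x \<in> rep ` Ext P" if "x \<in> Ext P" for x
      using rep[of x] that by (metis imageI)
    fix r c assume "r \<in> rep ` Ext P" "0 < c" "c *\<^sub>R r \<in> rep ` Ext P"
    moreover have "rep (rep x) = rep x" for x using rep[of x] rep_scale by metis
    ultimately show "c *\<^sub>R r = r" using rep_scale by (metis imageE)
  qed
  then show ?thesis by blast
qed

section \<open>Sublinear inequalities\<close>

lemma closed_valid_cone:
  fixes A :: "'a::euclidean_space \<Rightarrow> real^'m"
  shows "closed (valid_cone A K B)"
proof -
  have "valid_cone A K B = (\<Inter>x\<in>sol_set A K B. {g. snd g \<le> fst g \<bullet> x})"
    by (auto simp: valid_cone_def)
  then show ?thesis
    by (simp add: closed_INT closed_Collect_le continuous_intros)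
qed

lemma closed_sublinear_cone:
  fixes A :: "'a::euclidean_space \<Rightarrow> real^'m"
  shows "closed (sublinear_cone A K B)"
proof -
  have "sublinear_cone A K B = valid_cone A K B \<inter>
    (\<Inter>\<alpha>\<in>Ext (dual_cone K). \<Inter>u\<in>{u. A u = 0 \<and> (\<forall>v\<in>Ext K. (\<alpha> \<bullet> v) *\<^sub>R u + v \<in> K)}. {g. 0 \<le> fst g \<bullet> u})"
    by (auto simp: valid_cone_def sublinear_cone_def)
  moreover have "closed {g :: 'a \<times> real. 0 \<le> fst g \<bullet> u}" for u
    by (intro closed_Collect_le continuous_intros)
  ultimately show ?thesis
    by (simp add: closed_INT closed_Int closed_valid_cone)
qed

lemma sublinear_cone_subset: "sublinear_cone A K B \<subseteq> valid_cone A K B"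
  by (auto simp: sublinear_cone_def valid_cone_def)

lemma convex_cone_dual_cone: "convex_cone (dual_cone K)"
  by (auto simp: convex_cone_iff dual_cone_def inner_add_right)

text \<open>The condition on extreme rays of \<open>K\<close> extends to all of \<open>K\<close> because the shear is linear and
  \<open>K\<close> is generated by its extreme rays; the image under \<open>A\<close> is unchanged because \<open>A u = 0\<close>.\<close>

lemma shear_maps_sol_set:
  fixes A :: "'a::euclidean_space \<Rightarrow> real^'m"
  assumes K: "regular_cone K" and A: "linear A" and u: "A u = 0"
    and shear: "\<forall>v\<in>Ext K. (\<alpha> \<bullet> v) *\<^sub>R u + v \<in> K"
    and x: "x \<in> sol_set A K B"
  shows "(\<alpha> \<bullet> x) *\<^sub>R u + x \<in> sol_set A K B"
proof -
  have cK: "closed K" "convex_cone K" "\<And>x. x \<in> K \<Longrightarrow> - x \<in> K \<Longrightarrow> x = 0"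
    using K by (auto simp: regular_cone_def)
  let ?Z = "\<lambda>x. (\<alpha> \<bullet> x) *\<^sub>R u + x"
  have "convex_cone {x. ?Z x \<in> K}"
  proof -
    have "?Z (x + y) = ?Z x + ?Z y" "?Z (c *\<^sub>R x) = c *\<^sub>R ?Z x" for x y c
      by (simp_all add: inner_add_right algebra_simps)
    then show ?thesis using cK(2) by (simp only: convex_cone_iff mem_Collect_eq) auto
  qed
  moreover have "convex_cone hull (Ext K) = K"
    using Ext_subset[OF cK(2)] by (intro pointed_closed_cone_hull[OF cK]) (auto intro: exI[of _ 1])
  ultimately have "K \<subseteq> {x. ?Z x \<in> K}"
    using hull_minimal[of "Ext K" "{x. ?Z x \<in> K}" convex_cone] shear by auto
  then show ?thesis
    using x u by (auto simp: sol_set_def linear_add[OF A] linear_scale[OF A])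
qed

text \<open>A valid inequality evaluated at the sheared point \<open>x + (\<alpha> \<bullet> x) u\<close> reads
  \<open>\<eta> \<le> (\<mu> + (\<mu> \<bullet> u) \<alpha>) \<bullet> x\<close>, and a violation of sublinearity provides \<open>\<mu> \<bullet> u < 0\<close>.\<close>

lemma valid_cone_subtract_dual:
  fixes A :: "'a::euclidean_space \<Rightarrow> real^'m"
  assumes K: "regular_cone K" and A: "linear A"
    and g: "(\<mu>, \<eta>) \<in> valid_cone A K B" "(\<mu>, \<eta>) \<notin> sublinear_cone A K B"
  obtains \<delta> where "\<delta> \<in> dual_cone K - {0}" "(\<mu> - \<delta>, \<eta>) \<in> valid_cone A K B"
proof -
  obtain \<alpha> u where \<alpha>: "\<alpha> \<in> Ext (dual_cone K)" and u: "A u = 0"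
    and shear: "\<forall>v\<in>Ext K. (\<alpha> \<bullet> v) *\<^sub>R u + v \<in> K" and neg: "\<mu> \<bullet> u < 0"
    using g unfolding sublinear_cone_def valid_cone_def by (auto simp: not_le)
  let ?\<delta> = "(- (\<mu> \<bullet> u)) *\<^sub>R \<alpha>"
  have "?\<delta> \<in> Ext (dual_cone K)" using Ext_scaleR[OF \<alpha>, of "- (\<mu> \<bullet> u)"] neg by simp
  then have "?\<delta> \<in> dual_cone K - {0}"
    using Ext_subset[OF convex_cone_dual_cone] unfolding Ext_def by blast
  moreover have "\<eta> \<le> (\<mu> - ?\<delta>) \<bullet> x" if x: "x \<in> sol_set A K B" for x
  proof -
    have "\<eta> \<le> \<mu> \<bullet> ((\<alpha> \<bullet> x) *\<^sub>R u + x)"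
      using g(1) shear_maps_sol_set[OF K A u shear x] by (auto simp: valid_cone_def)
    then show ?thesis by (simp add: algebra_simps inner_simps)
  qed
  then have "(\<mu> - ?\<delta>, \<eta>) \<in> valid_cone A K B" by (simp add: valid_cone_def)
  ultimately show ?thesis using that by blast
qed

lemma not_K_minimal_subtract_dual:
  assumes "(\<mu> - \<delta>, \<eta>) \<in> valid_cone A K B" "\<delta> \<in> dual_cone K - {0}"
  shows "\<not> K_minimal A K B (\<mu>, \<eta>)"
proof
  assume "K_minimal A K B (\<mu>, \<eta>)"
  then have "\<And>\<rho> \<rho>\<^sub>0. (\<rho>, \<rho>\<^sub>0) \<in> valid_cone A K B \<Longrightarrow> \<rho> \<noteq> \<mu> \<Longrightarrow> \<mu> - \<rho> \<in> dual_cone K \<Longrightarrow> \<rho>\<^sub>0 < \<eta>"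
    unfolding K_minimal_def by auto
  from this[of "\<mu> - \<delta>" \<eta>] show False using assms by simp
qed

lemma implied_in_valid_cone: "\<delta> \<in> dual_cone K \<Longrightarrow> (\<delta>, 0) \<in> valid_cone A K B"
  by (auto simp: valid_cone_def sol_set_def dual_cone_def inner_commute)

lemma in_lineality_valid_cone_iff:
  "(\<mu>, \<eta>) \<in> lineality_space (valid_cone A K B) \<longleftrightarrow> (\<forall>x\<in>sol_set A K B. \<mu> \<bullet> x = \<eta>)"
proof -
  have "(\<mu>, \<eta>) \<in> uminus ` valid_cone A K B \<longleftrightarrow> (- \<mu>, - \<eta>) \<in> valid_cone A K B"
    by (force simp: image_iff)
  then show ?thesis
    unfolding lineality_space_eq(2)[OF convex_cone_valid_cone]
    by (auto simp: valid_cone_def intro: antisym)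
qed

text \<open>An inequality in the lineality space of the valid cone is tight at every solution, so no
  element of the dual cone that is positive at some solution can be subtracted from it.\<close>

lemma lineality_space_sublinear_cone:
  fixes A :: "'a::euclidean_space \<Rightarrow> real^'m"
  assumes K: "regular_cone K" and A: "linear A"
    and pos: "\<And>\<delta>. \<delta> \<in> dual_cone K - {0} \<Longrightarrow> \<exists>x\<in>sol_set A K B. 0 < \<delta> \<bullet> x"
  shows "lineality_space (sublinear_cone A K B) = lineality_space (valid_cone A K B)"
proof
  note S = lineality_space_properties[OF convex_cone_sublinear_cone[of A K B]]
  note V = lineality_space_properties[OF convex_cone_valid_cone[of A K B]]
  show "lineality_space (sublinear_cone A K B) \<subseteq> lineality_space (valid_cone A K B)"
    using S(1,2) sublinear_cone_subset by (intro V(3)) blast+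
  have "g \<in> sublinear_cone A K B" if g: "g \<in> lineality_space (valid_cone A K B)" for g
  proof (rule ccontr)
    assume ns: "g \<notin> sublinear_cone A K B"
    obtain \<mu> \<eta> where e: "g = (\<mu>, \<eta>)" by (cases g)
    have eq: "\<forall>x\<in>sol_set A K B. \<mu> \<bullet> x = \<eta>"
      using g unfolding e in_lineality_valid_cone_iff .
    have "(\<mu>, \<eta>) \<in> valid_cone A K B" using g V(2) e by blast
    then obtain \<delta> where \<delta>: "\<delta> \<in> dual_cone K - {0}" "(\<mu> - \<delta>, \<eta>) \<in> valid_cone A K B"
      using valid_cone_subtract_dual[OF K A] ns e by blast
    obtain x where x: "x \<in> sol_set A K B" "0 < \<delta> \<bullet> x" using pos \<delta>(1) by blast
    then have "\<eta> \<le> (\<mu> - \<delta>) \<bullet> x" using \<delta>(2) unfolding valid_cone_def by blast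
    then show False using x eq by (simp add: inner_diff_left)
  qed
  then show "lineality_space (valid_cone A K B) \<subseteq> lineality_space (sublinear_cone A K B)"
    using V(1) by (intro S(3)) blast+
qed

text \<open>A non-sublinear \<open>g\<close> is the sum of the valid inequality \<open>g - (\<delta>, 0)\<close> and the implied one
  \<open>(\<delta>, 0)\<close>. Projecting both along the lineality space keeps the sum, so the projection of \<open>(\<delta>, 0)\<close>
  is a multiple \<open>t *\<^sub>R g\<close>; here \<open>t \<noteq> 0\<close> because \<open>\<delta>\<close> is positive at some solution.\<close>

lemma extreme_valid_sublinear_or_implied:
  fixes A :: "'a::euclidean_space \<Rightarrow> real^'m"
  assumes K: "regular_cone K" and A: "linear A"
    and pos: "\<And>\<delta>. \<delta> \<in> dual_cone K - {0} \<Longrightarrow> \<exists>x\<in>sol_set A K B. 0 < \<delta> \<bullet> x"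
    and g: "g \<in> Ext (pointed_part (valid_cone A K B))" "g \<notin> sublinear_cone A K B"
  shows "\<exists>\<delta>\<in>dual_cone K - {0}. L_multiple (lineality_space (valid_cone A K B)) g (\<delta>, 0)"
proof -
  let ?V = "valid_cone A K B"
  let ?L = "lineality_space ?V" and ?P = "pointed_part ?V"
  have V: "convex_cone ?V" by (rule convex_cone_valid_cone)
  note P = convex_cone_pointed_part[OF V]
  note L = lineality_space_properties(1)[OF V]
  obtain \<mu> \<eta> where e: "g = (\<mu>, \<eta>)" by (cases g)
  have gP: "g \<in> ?P" using g(1) Ext_subset[OF P] by blast
  then have "(\<mu>, \<eta>) \<in> ?V" unfolding e pointed_part_def by blast
  then obtain \<delta> where \<delta>: "\<delta> \<in> dual_cone K - {0}" and rest: "(\<mu> - \<delta>, \<eta>) \<in> ?V"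
    using valid_cone_subtract_dual[OF K A] g(2) e by blast
  obtain l p where l: "l \<in> ?L" and p: "p \<in> ?P" and lp: "(\<delta>, 0) = l + p"
    using lineality_decomposition[OF V] implied_in_valid_cone \<delta> by (metis DiffD1)
  obtain l' q where l': "l' \<in> ?L" and q: "q \<in> ?P" and lq: "(\<mu> - \<delta>, \<eta>) = l' + q"
    using lineality_decomposition[OF V rest] by blast
  have "0 + g = (l + l') + (p + q)"
  proof -
    have "g = (\<delta>, 0) + (\<mu> - \<delta>, \<eta>)" using e by simp
    also have "\<dots> = (l + l') + (p + q)" unfolding lp lq by (simp add: algebra_simps)
    finally show ?thesis by simp
  qed
  then have "g = p + q"
    using orthogonal_decomposition_unique(2)[OF L subspace_0[OF L] subspace_add[OF L l l'], of g "p + q"]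
      gP convex_cone_add[OF P p q] unfolding pointed_part_def by blast
  then obtain t where t: "0 \<le> t" "p = t *\<^sub>R g"
    using g(1) p q unfolding Ext_iff[OF P] by metis
  have "t \<noteq> 0"
  proof
    assume "t = 0"
    then have "(\<delta>, 0) \<in> ?L" using lp l t by simp
    then have "\<forall>x\<in>sol_set A K B. \<delta> \<bullet> x = 0" by (simp add: in_lineality_valid_cone_iff)
    then show False using pos[OF \<delta>] by auto
  qed
  then have t0: "0 < t" using t by simp
  have "g = (1/t) *\<^sub>R p" using t t0 by simp
  also have "p = (\<delta>, 0) - l" using lp by simp
  finally have "g = (1/t) *\<^sub>R (\<delta>, 0) + (- (1/t)) *\<^sub>R l" by (simp add: scaleR_diff_right)
  moreover have "(- (1/t)) *\<^sub>R l \<in> ?L" using L l by (rule subspace_scale)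
  ultimately have "L_multiple ?L g (\<delta>, 0)"
    unfolding L_multiple_def using t0 by (intro exI[of _ "1/t"] exI[of _ "(- (1/t)) *\<^sub>R l"]) simp
  then show ?thesis using \<delta> by blast
qed

text \<open>Being closed under conic combinations, this set contains everything that the implied
  generators generate.\<close>

lemma convex_cone_implied_plus_lineality:
  fixes A :: "'a::euclidean_space \<Rightarrow> real^'m"
  shows "convex_cone {(\<delta>, 0) + l | \<delta> l. \<delta> \<in> dual_cone K \<and> l \<in> lineality_space (valid_cone A K B)}"
    (is "convex_cone ?J")
proof -
  let ?I = "(\<lambda>\<delta>. (\<delta>, 0::real)) ` dual_cone K" and ?L = "lineality_space (valid_cone A K B)"
  have "linear (\<lambda>\<delta>. (\<delta>, 0) :: 'a \<times> real)" by (simp add: linear_iff)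
  then have "convex_cone ?I"
    by (intro convex_cone_linear_image conjI convex_cone_dual_cone)
  moreover have "convex_cone ?L"
    by (intro subspace_imp_convex_cone lineality_space_properties(1) convex_cone_valid_cone)
  ultimately have "convex_cone (\<Union>x\<in>?I. \<Union>y\<in>?L. {x + y})"
    by (rule convex_cone_sums)
  moreover have "?J = (\<Union>x\<in>?I. \<Union>y\<in>?L. {x + y})" by blast
  ultimately show ?thesis by (simp only:)
qed

theorem theorem3p2:
  fixes A :: "'a::euclidean_space \<Rightarrow> real^'m"
    and K :: "'a set"
    and B :: "(real^'m) set"
    and G\<^sub>L G\<^sub>s :: "('a \<times> real) set"
  assumes "regular_cone K"
    and "linear A"
    and "B \<noteq> {}"
    and "sol_set A K B \<noteq> {}"
    and "sol_set A K B \<noteq> K"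
    and "\<And>\<delta>. \<delta> \<in> dual_cone K - {0} \<Longrightarrow> \<exists>x\<in>sol_set A K B. 0 < \<delta> \<bullet> x"
    and "generating_set (sublinear_cone A K B) G\<^sub>L G\<^sub>s"
  shows "\<exists>G\<^sub>C. generating_set (valid_cone A K B) G\<^sub>L G\<^sub>C \<and>
           non_implied_generators A K B G\<^sub>C \<subseteq> G\<^sub>s \<and>
           (\<forall>g\<in>G\<^sub>s - non_implied_generators A K B G\<^sub>C. \<not> K_minimal A K B g)"
proof -
  let ?V = "valid_cone A K B" and ?S = "sublinear_cone A K B"
  let ?L = "lineality_space ?V"
  define P where "P = pointed_part ?V"
  define Q where "Q = pointed_part ?S"
  have V: "convex_cone ?V" by (rule convex_cone_valid_cone)
  have S: "convex_cone ?S" by (rule convex_cone_sublinear_cone)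
  have P: "convex_cone P" unfolding P_def by (rule convex_cone_pointed_part[OF V])
  have Q: "convex_cone Q" unfolding Q_def by (rule convex_cone_pointed_part[OF S])
  have LS: "lineality_space ?S = ?L" by (rule lineality_space_sublinear_cone[OF assms(1,2,6)])
  have QP: "Q = P \<inter> ?S"
    unfolding P_def Q_def pointed_part_def LS using sublinear_cone_subset by blast
  have gsS: "span G\<^sub>L = ?L \<and> (\<forall>H\<subseteq>G\<^sub>L. span H = ?L \<longrightarrow> H = G\<^sub>L)" and Gs: "ray_transversal Q G\<^sub>s"
    using assms(7) unfolding generating_set_iff[OF closed_sublinear_cone S] LS Q_def by blast+
  obtain T where T: "ray_transversal P T" using ray_transversal_exists by blast
  \<comment> \<open>Reuse the given representative on each extreme ray of \<open>P\<close> that lies in \<open>Q\<close>; the others are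
    chosen freely.\<close>
  define G\<^sub>C where "G\<^sub>C = (G\<^sub>s \<inter> Ext P) \<union> (T - Q)"
  have GsQ: "G\<^sub>s \<subseteq> Q" using Gs Ext_subset[OF Q] unfolding ray_transversal_def by blast
  have scale_Q: "c *\<^sub>R x \<in> Q \<longleftrightarrow> x \<in> Q" if "0 < c" for c x
    using convex_cone_scaleR[OF Q, of c x] convex_cone_scaleR[OF Q, of "1/c" "c *\<^sub>R x"] that by auto
  have GC: "ray_transversal P G\<^sub>C"
  proof (rule ray_transversalI)
    show "G\<^sub>C \<subseteq> Ext P" using T unfolding G\<^sub>C_def ray_transversal_def by blast
  next
    fix x assume x: "x \<in> Ext P"
    show "\<exists>c>0. c *\<^sub>R x \<in> G\<^sub>C"
    proof (cases "x \<in> Q")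
      case True
      then have "x \<in> Ext Q" using Ext_subcone[OF P Q _ x] QP by blast
      then obtain c where "0 < c" "c *\<^sub>R x \<in> G\<^sub>s" using Gs unfolding ray_transversal_def by blast
      then show ?thesis using Ext_scaleR[OF x] unfolding G\<^sub>C_def by blast
    next
      case False
      obtain c where "0 < c" "c *\<^sub>R x \<in> T" using T x unfolding ray_transversal_def by blast
      then show ?thesis using False scale_Q unfolding G\<^sub>C_def by blast
    qed
  next
    fix r c assume r: "r \<in> G\<^sub>C" and c: "0 < c" "c *\<^sub>R r \<in> G\<^sub>C"
    show "c *\<^sub>R r = r"
    proof (cases "r \<in> Q")
      case True
      then have "r \<in> G\<^sub>s" "c *\<^sub>R r \<in> G\<^sub>s" using r c scale_Q unfolding G\<^sub>C_def by blast+
      then show ?thesis using ray_transversal_unique[OF Gs] c(1) by blast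
    next
      case False
      then have "r \<in> T" "c *\<^sub>R r \<in> T" using r c scale_Q GsQ unfolding G\<^sub>C_def by blast+
      then show ?thesis using ray_transversal_unique[OF T] c(1) by blast
    qed
  qed
  have genC: "generating_set ?V G\<^sub>L G\<^sub>C"
    unfolding generating_set_iff[OF closed_valid_cone V] P_def[symmetric] using gsS GC by blast
  let ?N = "non_implied_generators A K B G\<^sub>C"
  have NGs: "?N \<subseteq> G\<^sub>s"
  proof
    fix g assume g: "g \<in> ?N"
    then have gC: "g \<in> G\<^sub>C"
      and ni: "\<not> (\<exists>\<delta>\<in>dual_cone K - {0}. L_multiple ?L g (\<delta>, 0))"
      unfolding non_implied_generators_def by blast+
    have gE: "g \<in> Ext P" using gC GC unfolding ray_transversal_def by blast
    then have "g \<in> ?S"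
      using extreme_valid_sublinear_or_implied[OF assms(1,2,6)] ni unfolding P_def by blast
    then have "g \<in> Q" using gE Ext_subset[OF P] QP by blast
    then show "g \<in> G\<^sub>s" using gC unfolding G\<^sub>C_def by blast
  qed
  have "\<not> K_minimal A K B g" if g: "g \<in> G\<^sub>s - ?N" for g
  proof
    assume minimal: "K_minimal A K B g"
    let ?J = "{(\<delta>, 0) + l | \<delta> l. \<delta> \<in> dual_cone K \<and> l \<in> ?L}"
    have gQ: "g \<in> Q" using g GsQ by blast
    \<comment> \<open>Split \<open>g\<close> into the contributions of non-implied and of implied generators.\<close>
    have "P = convex_cone hull (?N \<union> (G\<^sub>C - ?N))"
    proof -
      have "?N \<subseteq> G\<^sub>C" unfolding non_implied_generators_def by blast
      then have "?N \<union> (G\<^sub>C - ?N) = G\<^sub>C" by blast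
      moreover have "convex_cone hull G\<^sub>C = P"
        using genC generated_set_eq_iff[OF V, of G\<^sub>L G\<^sub>C]
        unfolding generating_set_def P_def pointed_part_def by blast
      ultimately show ?thesis by simp
    qed
    then obtain p q where p: "p \<in> convex_cone hull ?N" and q: "q \<in> convex_cone hull (G\<^sub>C - ?N)"
      and gpq: "g = p + q"
      using gQ QP unfolding convex_cone_hull_Un by blast
    have "convex_cone hull (G\<^sub>C - ?N) \<subseteq> ?J"
    proof (rule hull_minimal)
      show "G\<^sub>C - ?N \<subseteq> ?J"
      proof
        fix h assume "h \<in> G\<^sub>C - ?N"
        then obtain \<delta> \<tau> l where "\<delta> \<in> dual_cone K" "0 < \<tau>" "l \<in> ?L" "h = \<tau> *\<^sub>R (\<delta>, 0) + l"
          unfolding non_implied_generators_def L_multiple_def by blast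
        then show "h \<in> ?J"
          using convex_cone_scaleR[OF convex_cone_dual_cone, of \<tau> \<delta> K]
          unfolding mem_Collect_eq by (intro exI[of _ "\<tau> *\<^sub>R \<delta>"] exI[of _ l]) simp
      qed
    qed (rule convex_cone_implied_plus_lineality)
    then obtain \<delta> l where \<delta>: "\<delta> \<in> dual_cone K" and l: "l \<in> ?L" and ql: "q = (\<delta>, 0) + l"
      using q by blast
    have hNQ: "convex_cone hull ?N \<subseteq> Q" using NGs GsQ Q by (intro hull_minimal) blast+
    show False
    proof (cases "\<delta> = 0")
      case False
      obtain \<mu> \<eta> where e: "g = (\<mu>, \<eta>)" by (cases g)
      have "p + l \<in> ?V"
        using p hNQ QP l lineality_space_properties(2)[OF V] convex_cone_add[OF V]
        unfolding P_def pointed_part_def by blast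
      moreover have "p + l = g - (\<delta>, 0)" unfolding gpq ql by simp
      ultimately have "(\<mu> - \<delta>, \<eta>) \<in> ?V" using e by simp
      then show False using not_K_minimal_subtract_dual minimal \<delta> False e by blast
    next
      case True
      then have q_eq: "q = l" using ql by (simp flip: zero_prod_def)
      have "0 + g = l + p" using gpq q_eq by simp
      then have "g = p"
        using orthogonal_decomposition_unique(2)[OF lineality_space_properties(1)[OF V] _ l, of 0 g p]
          subspace_0[OF lineality_space_properties(1)[OF V]] p hNQ gQ QP
        unfolding P_def pointed_part_def by blast
      \<comment> \<open>Extremality passes to the subcone generated by the non-implied generators, so one of them
        lies on the ray of \<open>g\<close>; both represent that ray in \<open>G\<^sub>s\<close>.\<close>
      then have gN: "g \<in> convex_cone hull ?N" using p by simp
      have "g \<in> Ext Q" using g Gs unfolding ray_transversal_def by blast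
      then have "g \<in> Ext (convex_cone hull ?N)"
        by (rule Ext_subcone[OF Q convex_cone_convex_cone_hull hNQ _ gN])
      then obtain c where c: "0 < c" "c *\<^sub>R g \<in> ?N"
        using generators_meet_Ext[OF convex_cone_convex_cone_hull refl] by blast
      then have "c *\<^sub>R g = g" using ray_transversal_unique[OF Gs, of g c] g NGs by blast
      then show False using c g by simp
    qed
  qed
  then show ?thesis using genC NGs by blast
qed

end
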